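(* Let $\mathcal C\subset\mathbb{RP}^2$ be a non-degenerate cubic such that there exist distinct $A,B,C,D\in\mathbb R^2$ for which $\mathcal C$ is the isogonal cubic of $ABCD$. Let $P$ be the spiral center of $ABCD$, and let $\mathcal C_0$ denote the embedding of $\mathcal C$ in $\mathbb{CP}^2$. Let $I=(1:i:0)$ and $J=(1:-i:0)$ be the circular points at infinity. Then the lines $PI$ and $PJ$ are tangent to $\mathcal C_0$ at $I$ and $J$, respectively.
   Context: A cubic is non-degenerate if it is irreducible. Pairs of lines $(XA,XC)$, $(XB,XD)$ through a point $X\in\mathbb R^2$ are isogonal if they have the same pair of angle bisectors. The isogonal cubic of $ABCD$ is the locus of points $X$ for which $(XA,XC)$ and $(XB,XD)$ are isogonal; identifying $\mathbb R^2$ with the complex plane and writing lower-case letters for complex coordinates, its equation is $(x-b)(x-d)\,\overline{(x-a)(x-c)}=\overline{(x-b)(x-d)}\,(x-a)(x-c)$ (the degree-4 terms cancel), and it is completed projectively. Non-degeneracy forces $a+c\ne b+d$. The spiral center of $ABCD$ is the center of the spiral similarity taking $A\mapsto B$ and $D\mapsto C$ (equivalently $A\mapsto D$, $B\mapsto C$), i.e. the unique point $P$ with $(a-p)(c-p)=(b-p)(d-p)$. *)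

theory Defs
  imports "HOL-Analysis.Analysis" "HOL-Computational_Algebra.Polynomial"
begin

section \<open>The projective plane over a field\<close>

definition proj_rel :: "'a::field \<times> 'a \<times> 'a \<Rightarrow> 'a \<times> 'a \<times> 'a \<Rightarrow> bool" where
  "proj_rel u v \<longleftrightarrow> u \<noteq> (0, 0, 0) \<and> v \<noteq> (0, 0, 0) \<and>
     (\<exists>k. k \<noteq> 0 \<and> v = (k * fst u, k * fst (snd u), k * snd (snd u)))"

lemma part_equivp_proj_rel: "part_equivp (proj_rel :: 'a::field \<times> 'a \<times> 'a \<Rightarrow> _)"
proof (rule part_equivpI)
  show "\<exists>u. proj_rel u (u :: 'a \<times> 'a \<times> 'a)"
    by (rule exI[of _ "(1, 0, 0)"]) (auto simp: proj_rel_def intro!: exI[of _ 1])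
  show "symp (proj_rel :: 'a \<times> 'a \<times> 'a \<Rightarrow> _)"
  proof (rule sympI)
    fix u v :: "'a \<times> 'a \<times> 'a" assume "proj_rel u v"
    then obtain k where k: "u \<noteq> (0, 0, 0)" "v \<noteq> (0, 0, 0)" "k \<noteq> 0"
      "v = (k * fst u, k * fst (snd u), k * snd (snd u))"
      unfolding proj_rel_def by blast
    have "u = (inverse k * fst v, inverse k * fst (snd v), inverse k * snd (snd v))"
      using k(3) by (simp add: k(4) prod_eq_iff)
    then show "proj_rel v u" using k(1-3) unfolding proj_rel_def
      by (metis inverse_zero_imp_zero)
  qed
  show "transp (proj_rel :: 'a \<times> 'a \<times> 'a \<Rightarrow> _)"
  proof (rule transpI)
    fix u v w :: "'a \<times> 'a \<times> 'a" assume "proj_rel u v" "proj_rel v w"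
    then obtain k l where k: "u \<noteq> (0, 0, 0)" "w \<noteq> (0, 0, 0)" "k \<noteq> 0" "l \<noteq> 0"
      "v = (k * fst u, k * fst (snd u), k * snd (snd u))"
      "w = (l * fst v, l * fst (snd v), l * snd (snd v))"
      unfolding proj_rel_def by blast
    have "w = ((l * k) * fst u, (l * k) * fst (snd u), (l * k) * snd (snd u))"
      by (simp add: k(5,6) mult.assoc)
    then show "proj_rel u w" using k(1-4) unfolding proj_rel_def
      by (metis no_zero_divisors)
  qed
qed

quotient_type (overloaded) 'a proj2 = "'a::field \<times> 'a \<times> 'a" / partial: proj_rel
  by (rule part_equivp_proj_rel)

text \<open>\<open>hpt x y z\<close> is the point \<open>(x : y : z)\<close>; it is only meaningful for \<open>(x, y, z) \<noteq> (0, 0, 0)\<close>.\<close>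

definition hpt :: "'a::field \<Rightarrow> 'a \<Rightarrow> 'a \<Rightarrow> 'a proj2" where
  "hpt x y z = abs_proj2 (x, y, z)"

definition hcoords :: "'a::field proj2 \<Rightarrow> ('a \<times> 'a \<times> 'a) set" where
  "hcoords Q = {(x, y, z). (x, y, z) \<noteq> (0, 0, 0) \<and> Q = hpt x y z}"

lemma hcoords_hpt:
  fixes x y z :: "'a::field"
  assumes "(x, y, z) \<noteq> (0, 0, 0)"
  shows "hcoords (hpt x y z) = {(k * x, k * y, k * z) | k. k \<noteq> 0}"
proof -
  have eq: "hpt x y z = hpt x' y' z' \<longleftrightarrow> proj_rel (x, y, z) (x', y', z')"
    if "(x', y', z') \<noteq> (0, 0, 0)" for x' y' z' :: 'a
  proof -
    have refl: "proj_rel u u" if "u \<noteq> (0, 0, 0)" for u :: "'a \<times> 'a \<times> 'a"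
      using that by (auto simp: proj_rel_def intro!: exI[of _ 1])
    show ?thesis
      unfolding hpt_def using Quotient3_rel[OF Quotient3_proj2] refl assms that by metis
  qed
  show ?thesis
    unfolding hcoords_def using assms by (auto simp: eq proj_rel_def)
qed

definition line_of_coeffs :: "'a::field \<Rightarrow> 'a \<Rightarrow> 'a \<Rightarrow> 'a proj2 set" where
  "line_of_coeffs l m n = {Q. \<exists>(x, y, z) \<in> hcoords Q. l * x + m * y + n * z = 0}"

text \<open>The line joining two distinct points.\<close>

definition line_through :: "'a::field proj2 \<Rightarrow> 'a proj2 \<Rightarrow> 'a proj2 set" where
  "line_through P Q = {R. \<exists>(x1, y1, z1) \<in> hcoords P. \<exists>(x2, y2, z2) \<in> hcoords Q. \<exists>s t.
     (s * x1 + t * x2, s * y1 + t * y2, s * z1 + t * z2) \<in> hcoords R}"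

section \<open>Plane projective curves\<close>

text \<open>
  A polynomial in \<open>x, y, z\<close> is an element of \<open>K[x][y][z]\<close>: the innermost variable is \<open>x\<close>, the
  outermost is \<open>z\<close>. A plane curve is given by its defining form, which is unique up to a nonzero
  scalar.
\<close>

type_synonym 'a poly3 = "'a poly poly poly"

definition eval3 :: "'a::comm_ring_1 poly3 \<Rightarrow> 'a \<Rightarrow> 'a \<Rightarrow> 'a \<Rightarrow> 'a" where
  "eval3 F x y z = poly (poly (poly F [:[:z:]:]) [:y:]) x"

definition coeff3 :: "'a::comm_ring_1 poly3 \<Rightarrow> nat \<Rightarrow> nat \<Rightarrow> nat \<Rightarrow> 'a" where
  "coeff3 F i j k = coeff (coeff (coeff F k) j) i"

definition homogeneous3 :: "nat \<Rightarrow> 'a::comm_ring_1 poly3 \<Rightarrow> bool" where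
  "homogeneous3 d F \<longleftrightarrow> (\<forall>i j k. coeff3 F i j k \<noteq> 0 \<longrightarrow> i + j + k = d)"

definition cubic :: "'a::field poly3 \<Rightarrow> bool" where
  "cubic F \<longleftrightarrow> F \<noteq> 0 \<and> homogeneous3 3 F"

definition nondegenerate_cubic :: "'a::field poly3 \<Rightarrow> bool" where
  "nondegenerate_cubic F \<longleftrightarrow> cubic F \<and> irreducible F"

definition curve_points :: "'a::field poly3 \<Rightarrow> 'a proj2 set" where
  "curve_points F = {Q. \<forall>(x, y, z) \<in> hcoords Q. eval3 F x y z = 0}"

definition dx :: "'a::field poly3 \<Rightarrow> 'a poly3" where "dx = map_poly (map_poly pderiv)"
definition dy :: "'a::field poly3 \<Rightarrow> 'a poly3" where "dy = map_poly pderiv"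
definition dz :: "'a::field poly3 \<Rightarrow> 'a poly3" where "dz = pderiv"

text \<open>
  \<open>L\<close> is the tangent line of the curve \<open>F = 0\<close> at its point \<open>Q\<close>; this includes that \<open>Q\<close> is a
  nonsingular point of the curve.
\<close>

definition tangent_at :: "'a::field poly3 \<Rightarrow> 'a proj2 \<Rightarrow> 'a proj2 set \<Rightarrow> bool" where
  "tangent_at F Q L \<longleftrightarrow> Q \<in> curve_points F \<and>
     (\<forall>(x, y, z) \<in> hcoords Q.
        (eval3 (dx F) x y z, eval3 (dy F) x y z, eval3 (dz F) x y z) \<noteq> (0, 0, 0) \<and>
        L = line_of_coeffs (eval3 (dx F) x y z) (eval3 (dy F) x y z) (eval3 (dz F) x y z))"

definition complexify :: "real poly3 \<Rightarrow> complex poly3" where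
  "complexify = map_poly (map_poly (map_poly complex_of_real))"

definition circ_I :: "complex proj2" where "circ_I = hpt 1 \<i> 0"
definition circ_J :: "complex proj2" where "circ_J = hpt 1 (- \<i>) 0"

text \<open>The point \<open>p\<close> of the Euclidean plane, regarded as a point of the complex projective plane.\<close>

definition embed_pt :: "complex \<Rightarrow> complex proj2" where
  "embed_pt p = hpt (complex_of_real (Re p)) (complex_of_real (Im p)) 1"

section \<open>Isogonal pairs of lines and the isogonal cubic\<close>

definition line2 :: "complex \<Rightarrow> complex \<Rightarrow> complex set" where
  "line2 X v = {X + complex_of_real t * v | t. True}"

text \<open>Reflection in the line through \<open>X\<close> with direction \<open>w\<close>.\<close>

definition reflect :: "complex \<Rightarrow> complex \<Rightarrow> complex \<Rightarrow> complex" where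
  "reflect X w z = X + w / cnj w * cnj (z - X)"

text \<open>The two bisectors of the lines \<open>XA\<close> and \<open>XC\<close> are the lines through \<open>X\<close> whose reflection
  interchanges them.\<close>

definition bisectors :: "complex \<Rightarrow> complex \<Rightarrow> complex \<Rightarrow> complex set set" where
  "bisectors X A C =
     {line2 X w | w. w \<noteq> 0 \<and> reflect X w ` line2 X (A - X) = line2 X (C - X)}"

definition isogonal :: "complex \<Rightarrow> complex \<Rightarrow> complex \<Rightarrow> complex \<Rightarrow> complex \<Rightarrow> bool" where
  "isogonal X A C B D \<longleftrightarrow> bisectors X A C = bisectors X B D"

definition isog_expr :: "complex \<Rightarrow> complex \<Rightarrow> complex \<Rightarrow> complex \<Rightarrow> complex \<Rightarrow> complex" where
  "isog_expr a b c d x =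
     (x - b) * (x - d) * cnj ((x - a) * (x - c)) - cnj ((x - b) * (x - d)) * ((x - a) * (x - c))"

text \<open>
  The projective completion of the curve with affine equation \<open>isog_expr a b c d x = 0\<close>: the
  dehomogenisation of the cubic form \<open>F\<close> at \<open>z = 1\<close> is that expression, up to a nonzero constant.
  The expression takes purely imaginary values, so the constant is purely imaginary.
\<close>

definition is_isogonal_cubic ::
    "real poly3 \<Rightarrow> complex \<Rightarrow> complex \<Rightarrow> complex \<Rightarrow> complex \<Rightarrow> bool" where
  "is_isogonal_cubic F a b c d \<longleftrightarrow> cubic F \<and>
     (\<exists>k. k \<noteq> 0 \<and>
       (\<forall>x y. complex_of_real (eval3 F x y 1) = k * isog_expr a b c d (Complex x y)))"

lemma line2_eq_iff:
  assumes "v \<noteq> 0" "w \<noteq> 0"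
  shows "line2 X v = line2 X w \<longleftrightarrow> v / w \<in> \<real>"
proof
  assume "line2 X v = line2 X w"
  moreover have "X + v \<in> line2 X v" unfolding line2_def by (auto intro!: exI[of _ 1])
  ultimately obtain t where "X + v = X + complex_of_real t * w" unfolding line2_def by blast
  then have "v / w = complex_of_real t" using assms by simp
  then show "v / w \<in> \<real>" by simp
next
  assume "v / w \<in> \<real>"
  then obtain r where r: "v / w = complex_of_real r" by (auto elim: Reals_cases)
  then have v: "v = complex_of_real r * w" and "r \<noteq> 0"
    using assms by (auto simp: divide_simps split: if_splits)
  have "X + complex_of_real t * w = X + complex_of_real (t / r) * v" for t
    using \<open>r \<noteq> 0\<close> by (simp add: v)
  moreover have "X + complex_of_real t * v = X + complex_of_real (t * r) * w" for t
    by (simp add: v)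
  ultimately show "line2 X v = line2 X w" unfolding line2_def by blast
qed

lemma reflect_line2: "reflect X w ` line2 X v = line2 X (w / cnj w * cnj v)"
proof -
  have "reflect X w (X + complex_of_real t * v) = X + complex_of_real t * (w / cnj w * cnj v)" for t
    by (simp add: reflect_def)
  then show ?thesis unfolding line2_def by (auto simp: image_iff) (metis)
qed

lemma bisectors_eq:
  assumes "X \<noteq> A" "X \<noteq> C"
  shows "bisectors X A C = {line2 X w | w. w \<noteq> 0 \<and> w\<^sup>2 / ((X - A) * (X - C)) \<in> \<real>}"
proof -
  have "reflect X w ` line2 X (A - X) = line2 X (C - X) \<longleftrightarrow> w\<^sup>2 / ((X - A) * (X - C)) \<in> \<real>"
    if w: "w \<noteq> 0" for w
  proof -
    have nz: "w / cnj w * cnj (A - X) \<noteq> 0" "C - X \<noteq> 0" "cnj (X - A) \<noteq> 0"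
      using w assms by auto
    define r where "r = (cmod (X - A))\<^sup>2 / (cmod w)\<^sup>2"
    have r: "r \<noteq> 0" using w assms by (simp add: r_def)
    have "w / cnj w * cnj (A - X) / (C - X) = w / cnj w * cnj (X - A) / (X - C)"
    proof -
      have "p * cnj (A - X) / (C - X) = p * cnj (X - A) / (X - C)" for p
        by (metis complex_cnj_minus minus_diff_eq minus_divide_divide mult_minus_right)
      then show ?thesis .
    qed
    also have "\<dots> = complex_of_real r * (w\<^sup>2 / ((X - A) * (X - C)))"
    proof -
      have "complex_of_real r = (X - A) * cnj (X - A) / (w * cnj w)"
        by (simp only: r_def of_real_divide complex_norm_square)
      then show ?thesis using w assms by (simp add: power2_eq_square)
    qed
    finally have e: "w / cnj w * cnj (A - X) / (C - X) =
      complex_of_real r * (w\<^sup>2 / ((X - A) * (X - C)))" .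
    have "complex_of_real r * q \<in> \<real> \<longleftrightarrow> q \<in> \<real>" for q
      using r by (simp add: complex_is_Real_iff)
    then show ?thesis
      unfolding reflect_line2 line2_eq_iff[OF nz(1,2)] e by blast
  qed
  then show ?thesis unfolding bisectors_def by blast
qed

text \<open>Away from the four points themselves, the equation describes the isogonality locus.\<close>

lemma isogonal_iff_isog_expr:
  assumes "x \<notin> {a, b, c, d}"
  shows "isogonal x a c b d \<longleftrightarrow> isog_expr a b c d x = 0"
proof -
  define M where "M = (x - a) * (x - c)"
  define N where "N = (x - b) * (x - d)"
  have nz: "M \<noteq> 0" "N \<noteq> 0" using assms by (auto simp: M_def N_def)
  have real: "isog_expr a b c d x = 0 \<longleftrightarrow> M / N \<in> \<real>"
  proof -
    have "M / N \<in> \<real> \<longleftrightarrow> cnj (M / N) = M / N" by (simp add: Reals_cnj_iff)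
    also have "\<dots> \<longleftrightarrow> N * cnj M = cnj N * M" using nz by (auto simp: field_simps)
    finally show ?thesis by (simp add: isog_expr_def M_def N_def)
  qed
  have b: "bisectors x a c = {line2 x w | w. w \<noteq> 0 \<and> w\<^sup>2 / M \<in> \<real>}"
    "bisectors x b d = {line2 x w | w. w \<noteq> 0 \<and> w\<^sup>2 / N \<in> \<real>}"
    using assms by (simp_all add: bisectors_eq M_def N_def)
  show ?thesis
  proof
    assume "isogonal x a c b d"
    then have eq: "bisectors x a c = bisectors x b d" by (simp add: isogonal_def)
    define w where "w = csqrt M"
    have w: "w\<^sup>2 = M" "w \<noteq> 0" using nz by (auto simp: w_def)
    then have "line2 x w \<in> bisectors x a c" using nz unfolding b by auto
    then have "line2 x w \<in> bisectors x b d" by (simp add: eq)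
    then obtain v where v: "v \<noteq> 0" "line2 x w = line2 x v" "v\<^sup>2 / N \<in> \<real>"
      unfolding b by blast
    then have "w / v \<in> \<real>" using line2_eq_iff w by blast
    then have "(w / v)\<^sup>2 * (v\<^sup>2 / N) \<in> \<real>" using v(3) by (intro Reals_mult Reals_power)
    also have "(w / v)\<^sup>2 * (v\<^sup>2 / N) = M / N" using v(1) w by (simp add: power_divide)
    finally show "isog_expr a b c d x = 0" using real by simp
  next
    assume "isog_expr a b c d x = 0"
    then have R: "M / N \<in> \<real>" using real by simp
    then have R': "N / M \<in> \<real>" using Reals_inverse[OF R] by simp
    have "w\<^sup>2 / M \<in> \<real> \<longleftrightarrow> w\<^sup>2 / N \<in> \<real>" for w
    proof
      assume "w\<^sup>2 / M \<in> \<real>"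
      then have "w\<^sup>2 / M * (M / N) \<in> \<real>" using R by (rule Reals_mult)
      then show "w\<^sup>2 / N \<in> \<real>" using nz by simp
    next
      assume "w\<^sup>2 / N \<in> \<real>"
      then have "w\<^sup>2 / N * (N / M) \<in> \<real>" using R' by (rule Reals_mult)
      then show "w\<^sup>2 / M \<in> \<real>" using nz by simp
    qed
    then show "isogonal x a c b d" by (simp add: isogonal_def b)
  qed
qed

text \<open>
  The degree-4 terms of the equation cancel, so the required form exists; it is nonzero because
  the two pairs of points differ.
\<close>

lemma ex_isogonal_cubic:
  assumes "distinct [a, b, c, d]"
  shows "\<exists>F. is_isogonal_cubic F a b c d"
proof -
  define s where "s = a + c"
  define t where "t = b + d"
  define m where "m = a * c"
  define n where "n = b * d"
  define u where "u = Im (t * cnj s)"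
  define F :: "real poly3" where "F =
    [: [: [:0, 0, 0, Im s - Im t:], [:0, 0, Re t - Re s:], [:0, Im s - Im t:], [:Re t - Re s:] :],
       [: [:0, 0, Im n - Im m + u:], [:0, 2 * (Re m - Re n):], [:Im m - Im n + u:] :],
       [: [:0, - Im (t * cnj m + n * cnj s):], [:- Re (t * cnj m - n * cnj s):] :],
       [: [:Im (n * cnj m):] :] :]"
  have hom: "homogeneous3 3 F"
    unfolding homogeneous3_def coeff3_def F_def
    by (auto simp: coeff_pCons split: nat.splits)
  have ev: "eval3 F x y 1 = Im ((X\<^sup>2 - t * X + n) * cnj (X\<^sup>2 - s * X + m))"
    if "X = Complex x y" for x y X
    unfolding that eval3_def F_def u_def
    by (simp add: power2_eq_square algebra_simps)
  have ex: "isog_expr a b c d X =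
      2 * \<i> * complex_of_real (Im ((X\<^sup>2 - t * X + n) * cnj (X\<^sup>2 - s * X + m)))" for X
  proof -
    have 1: "(X - b) * (X - d) = X\<^sup>2 - t * X + n" "(X - a) * (X - c) = X\<^sup>2 - s * X + m"
      by (simp_all add: s_def t_def m_def n_def power2_eq_square algebra_simps)
    have "N * cnj M - cnj N * M = 2 * \<i> * complex_of_real (Im (N * cnj M))" for N M
      by (simp add: complex_eq_iff)
    then show ?thesis unfolding isog_expr_def 1 .
  qed
  have "F \<noteq> 0"
  proof
    assume "F = 0"
    then have "Re s = Re t" "Im s = Im t" "Re m = Re n" "Im n - Im m + u = 0" "Im m - Im n + u = 0"
      by (simp_all add: F_def)
    then have st: "s = t" "m = n" by (auto simp: complex_eq_iff)
    have "(a - b) * (a - d) = a * a - t * a + n" by (simp add: t_def n_def algebra_simps)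
    also have "\<dots> = a * a - s * a + m" by (simp add: st)
    also have "\<dots> = 0" by (simp add: s_def m_def algebra_simps)
    finally show False using assms by auto
  qed
  then have "is_isogonal_cubic F a b c d"
    unfolding is_isogonal_cubic_def cubic_def using hom
    by (auto simp: ev ex intro!: exI[of _ "1 / (2 * \<i>)"])
  then show ?thesis ..
qed

section \<open>The spiral center\<close>

definition spiral_similarity :: "complex \<Rightarrow> complex \<Rightarrow> complex \<Rightarrow> complex" where
  "spiral_similarity p k z = p + k * (z - p)"

definition is_spiral_center ::
    "complex \<Rightarrow> complex \<Rightarrow> complex \<Rightarrow> complex \<Rightarrow> complex \<Rightarrow> bool" where
  "is_spiral_center p a b c d \<longleftrightarrow>
     (\<exists>k. k \<noteq> 0 \<and> spiral_similarity p k a = b \<and> spiral_similarity p k d = c)"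

lemma is_spiral_center_iff:
  assumes "distinct [a, b, c, d]" "a + c \<noteq> b + d"
  shows "is_spiral_center p a b c d \<longleftrightarrow> (a - p) * (c - p) = (b - p) * (d - p)"
proof
  assume "is_spiral_center p a b c d"
  then obtain k where "b = p + k * (a - p)" "c = p + k * (d - p)"
    unfolding is_spiral_center_def spiral_similarity_def by metis
  then show "(a - p) * (c - p) = (b - p) * (d - p)" by simp
next
  assume e: "(a - p) * (c - p) = (b - p) * (d - p)"
  have nz: "a - p \<noteq> 0" "b - p \<noteq> 0" using e assms(1) by auto
  define k where "k = (b - p) / (a - p)"
  have "k * (a - p) = b - p" using nz by (simp add: k_def)
  moreover have "k * (d - p) = c - p" using nz e by (simp add: k_def field_simps)
  moreover have "k \<noteq> 0" using nz by (simp add: k_def)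
  ultimately show "is_spiral_center p a b c d"
    unfolding is_spiral_center_def spiral_similarity_def by (intro exI[of _ k]) simp
qed

lemma ex1_spiral_center:
  assumes "distinct [a, b, c, d]" "a + c \<noteq> b + d"
  shows "\<exists>!p. is_spiral_center p a b c d"
proof -
  have "(a - p) * (c - p) = (b - p) * (d - p) \<longleftrightarrow> p = (a * c - b * d) / (a + c - (b + d))" for p
  proof -
    have "(a - p) * (c - p) - (b - p) * (d - p) = (a * c - b * d) - p * (a + c - (b + d))"
      by (simp add: algebra_simps)
    then show ?thesis using assms(2)
      by (metis eq_divide_eq right_minus_eq)
  qed
  then show ?thesis unfolding is_spiral_center_iff[OF assms] by auto
qed

end

theory Submission
  imports Defs
begin

text \<open>
  Put \<open>w = (a + c) - (b + d)\<close> and \<open>v = a c - b d\<close>. Up to a real factor the isogonal cubic has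
  leading form \<open>(x\<^sup>2 + y\<^sup>2) (Im w x - Re w y)\<close>, and its gradient at \<open>(1 : i : 0)\<close> is proportional
  to \<open>(w, i w, - v)\<close>. If \<open>w = 0\<close> the cubic contains the line at infinity and is reducible;
  otherwise the spiral center satisfies \<open>p w = v\<close>, so that the tangent is \<open>x + i y = p z\<close>, the
  line joining \<open>P\<close> and \<open>I\<close>. The point \<open>J\<close> is the complex conjugate case.
\<close>

text \<open>\<open>cijk\<close> is the coefficient of x^i y^j z^k. Written out as nested coefficient
  lists, the general ternary cubic can be evaluated, differentiated and complexified by
  simplification.\<close>

definition cubic_form ::
    "'a::comm_ring_1 \<Rightarrow> 'a \<Rightarrow> 'a \<Rightarrow> 'a \<Rightarrow> 'a \<Rightarrow> 'a \<Rightarrow> 'a \<Rightarrow> 'a \<Rightarrow> 'a \<Rightarrow> 'a \<Rightarrow> 'a poly3" where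
  "cubic_form c300 c210 c120 c030 c201 c111 c021 c102 c012 c003 =
    [: [: [:0, 0, 0, c300:], [:0, 0, c210:], [:0, c120:], [:c030:] :],
       [: [:0, 0, c201:], [:0, c111:], [:c021:] :],
       [: [:0, c102:], [:c012:] :],
       [: [:c003:] :] :]"

lemma homogeneous3_cubic_form:
  assumes "homogeneous3 3 F"
  shows "F = cubic_form (coeff3 F 3 0 0) (coeff3 F 2 1 0) (coeff3 F 1 2 0) (coeff3 F 0 3 0)
    (coeff3 F 2 0 1) (coeff3 F 1 1 1) (coeff3 F 0 2 1) (coeff3 F 1 0 2) (coeff3 F 0 1 2)
    (coeff3 F 0 0 3)" (is "F = ?G")
proof -
  have zero: "coeff (coeff (coeff F k) j) i = 0" if "i + j + k \<noteq> 3" for i j k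
    using assms that unfolding homogeneous3_def coeff3_def by blast
  have "coeff (coeff (coeff F k) j) i = coeff (coeff (coeff ?G k) j) i" for i j k
    unfolding cubic_form_def coeff3_def
    by (auto simp: coeff_pCons numeral_2_eq_2 numeral_3_eq_3 zero split: nat.splits)
  then show ?thesis by (intro poly_eqI)
qed

lemma eval3_cubic_form:
  "eval3 (cubic_form c300 c210 c120 c030 c201 c111 c021 c102 c012 c003) x y z =
    c300 * x^3 + c210 * x^2 * y + c120 * x * y^2 + c030 * y^3 +
    (c201 * x^2 + c111 * x * y + c021 * y^2) * z + (c102 * x + c012 * y) * z^2 + c003 * z^3"
  unfolding eval3_def cubic_form_def
  by (simp add: power2_eq_square power3_eq_cube algebra_simps)

text \<open>I and J lie on z = 0. There \<open>c102\<close>, \<open>c012\<close> and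
  \<open>c003\<close> drop out of the gradient, so \<open>isogonal_cubic_coeffs\<close> can leave
  them unspecified.\<close>

lemma eval3_gradient_cubic_form:
  fixes c300 :: "'a::field"
  shows "eval3 (dx (cubic_form c300 c210 c120 c030 c201 c111 c021 c102 c012 c003)) x y 0 =
      3 * c300 * x^2 + 2 * c210 * x * y + c120 * y^2"
    and "eval3 (dy (cubic_form c300 c210 c120 c030 c201 c111 c021 c102 c012 c003)) x y 0 =
      c210 * x^2 + 2 * c120 * x * y + 3 * c030 * y^2"
    and "eval3 (dz (cubic_form c300 c210 c120 c030 c201 c111 c021 c102 c012 c003)) x y 0 =
      c201 * x^2 + c111 * x * y + c021 * y^2"
  unfolding eval3_def cubic_form_def dx_def dy_def dz_def
  by (simp_all add: map_poly_pCons pderiv_pCons power2_eq_square algebra_simps)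

lemma complexify_cubic_form:
  "complexify (cubic_form c300 c210 c120 c030 c201 c111 c021 c102 c012 c003) =
    cubic_form (of_real c300) (of_real c210) (of_real c120) (of_real c030) (of_real c201)
      (of_real c111) (of_real c021) (of_real c102) (of_real c012) (of_real c003)"
  unfolding complexify_def cubic_form_def by (simp add: map_poly_pCons)

text \<open>The ten points \<open>(x, y)\<close> with \<open>x, y \<ge> 0\<close> integers and \<open>x + y \<le> 3\<close> are unisolvent for cubics.\<close>

lemma cubic_polynomial_zero:
  fixes c300 :: real
  assumes "\<And>x y. c300 * x^3 + c210 * x^2 * y + c120 * x * y^2 + c030 * y^3 +
    (c201 * x^2 + c111 * x * y + c021 * y^2) + (c102 * x + c012 * y) + c003 = 0"
  shows "c300 = 0 \<and> c210 = 0 \<and> c120 = 0 \<and> c030 = 0 \<and> c201 = 0 \<and> c111 = 0 \<and> c021 = 0 \<and>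
    c102 = 0 \<and> c012 = 0 \<and> c003 = 0"
proof -
  have c003: "c003 = 0" using assms[of 0 0] by simp
  have x: "c300 + c201 + c102 = 0" "8 * c300 + 4 * c201 + 2 * c102 = 0"
    "27 * c300 + 9 * c201 + 3 * c102 = 0"
    using assms[of 1 0] assms[of 2 0] assms[of 3 0] c003 by simp_all
  then have x': "c300 = 0" "c201 = 0" "c102 = 0" by linarith+
  have y: "c030 + c021 + c012 = 0" "8 * c030 + 4 * c021 + 2 * c012 = 0"
    "27 * c030 + 9 * c021 + 3 * c012 = 0"
    using assms[of 0 1] assms[of 0 2] assms[of 0 3] c003 by simp_all
  then have y': "c030 = 0" "c021 = 0" "c012 = 0" by linarith+
  \<comment> \<open>What remains is x y (c210 x + c120 y + c111). Its affine factor vanishes at the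
    non-collinear points (1,1), (2,1), (1,2), hence identically.\<close>
  have "c210 + c120 + c111 = 0" "4 * c210 + 2 * c120 + 2 * c111 = 0"
    "2 * c210 + 4 * c120 + 2 * c111 = 0"
    using assms[of 1 1] assms[of 2 1] assms[of 1 2] c003 x' y' by simp_all
  then have "c210 = 0" "c120 = 0" "c111 = 0" by linarith+
  then show ?thesis using c003 x' y' by simp
qed

text \<open>With N = X^2 - t X + n and M = X^2 - s X + m, the equation is Im (N cnj M) = 0. The
  quartic term is real, the cubic part is |X|^2 Im (w cnj X), and the quadratic part is u |X|^2 - Im
  (v cnj (X^2)).\<close>

lemma isogonal_cubic_coeffs:
  assumes "is_isogonal_cubic F a b c d"
  defines "w \<equiv> (a + c) - (b + d)" and "v \<equiv> a * c - b * d"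
  obtains r u e f g where "r \<noteq> 0"
    "F = cubic_form (r * Im w) (- r * Re w) (r * Im w) (- r * Re w)
       (r * (u - Im v)) (2 * r * Re v) (r * (u + Im v)) e f g"
proof -
  define s t m n where "s = a + c" and "t = b + d" and "m = a * c" and "n = b * d"
  define u where "u = Im (t * cnj s)"
  obtain k where hom: "homogeneous3 3 F" and "k \<noteq> 0"
    and k: "\<And>x y. complex_of_real (eval3 F x y 1) = k * isog_expr a b c d (Complex x y)"
    and "F \<noteq> 0"
    using assms(1) unfolding is_isogonal_cubic_def cubic_def by blast
  \<comment> \<open>Since \<open>isog_expr\<close> is 2 i times a real number, taking real parts
    gives a real factor without first showing that 2 i k is real.\<close>
  define r where "r = Re (2 * \<i> * k)"
  have wv: "w = s - t" "v = m - n"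
    by (simp_all add: w_def v_def s_def t_def m_def n_def)
  have expr: "isog_expr a b c d X =
      2 * \<i> * complex_of_real (Im ((X\<^sup>2 - t * X + n) * cnj (X\<^sup>2 - s * X + m)))" for X
  proof -
    have 1: "(X - b) * (X - d) = X\<^sup>2 - t * X + n" "(X - a) * (X - c) = X\<^sup>2 - s * X + m"
      by (simp_all add: s_def t_def m_def n_def power2_eq_square algebra_simps)
    have "N * cnj M - cnj N * M = 2 * \<i> * complex_of_real (Im (N * cnj M))" for N M
      by (simp add: complex_eq_iff)
    then show ?thesis unfolding isog_expr_def 1 .
  qed
  have ev: "eval3 F x y 1 = r * Im (((Complex x y)\<^sup>2 - t * Complex x y + n) *
      cnj ((Complex x y)\<^sup>2 - s * Complex x y + m))" for x y
  proof -
    have "Re (complex_of_real (eval3 F x y 1)) = Re (2 * \<i> * k * complex_of_real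
      (Im (((Complex x y)\<^sup>2 - t * Complex x y + n) * cnj ((Complex x y)\<^sup>2 - s * Complex x y + m))))"
      unfolding k expr by (simp add: ac_simps)
    then show ?thesis unfolding r_def by simp
  qed
  obtain c300 c210 c120 c030 c201 c111 c021 c102 c012 c003 where
    F: "F = cubic_form c300 c210 c120 c030 c201 c111 c021 c102 c012 c003"
    using homogeneous3_cubic_form[OF hom] by metis
  \<comment> \<open>The coefficients of \<open>F\<close> minus those of r Im (N cnj M), with z = 1:
    this difference vanishes at every real point.\<close>
  have "(c300 - r * Im w) * x^3 + (c210 + r * Re w) * x^2 * y + (c120 - r * Im w) * x * y^2 +
      (c030 + r * Re w) * y^3 +
      ((c201 - r * (u - Im v)) * x^2 + (c111 - 2 * r * Re v) * x * y +
        (c021 - r * (u + Im v)) * y^2) +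
      ((c102 + r * Im (t * cnj m + n * cnj s)) * x +
        (c012 + r * Re (t * cnj m - n * cnj s)) * y) + (c003 - r * Im (n * cnj m)) = 0" for x y
    using ev[of x y] unfolding F eval3_cubic_form wv u_def
    by (simp add: power2_eq_square power3_eq_cube algebra_simps)
  from cubic_polynomial_zero[OF this]
  have "c300 = r * Im w" "c210 = - r * Re w" "c120 = r * Im w" "c030 = - r * Re w"
    "c201 = r * (u - Im v)" "c111 = 2 * r * Re v" "c021 = r * (u + Im v)"
    "c102 = - r * Im (t * cnj m + n * cnj s)" "c012 = - r * Re (t * cnj m - n * cnj s)"
    "c003 = r * Im (n * cnj m)"
    unfolding mult_minus_left by linarith+
  then have F': "F = cubic_form (r * Im w) (- r * Re w) (r * Im w) (- r * Re w)
       (r * (u - Im v)) (2 * r * Re v) (r * (u + Im v)) (- r * Im (t * cnj m + n * cnj s))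
       (- r * Re (t * cnj m - n * cnj s)) (r * Im (n * cnj m))"
    unfolding F by simp
  \<comment> \<open>\<open>k\<close> being nonzero says nothing about the real part of 2 i k alone;
    it is \<open>F\<close> being nonzero that excludes r = 0.\<close>
  moreover have "r \<noteq> 0"
  proof
    assume "r = 0"
    then have "F = 0" using F' by (simp add: cubic_form_def)
    then show False using \<open>F \<noteq> 0\<close> by simp
  qed
  ultimately show thesis using that by blast
qed

text \<open>The form is z times a quadratic form, and neither factor is a unit.\<close>

lemma not_irreducible_cubic_form_at_infinity:
  fixes c201 :: "'a::field"
  shows "\<not> irreducible (cubic_form 0 0 0 0 c201 c111 c021 c102 c012 c003)" (is "\<not> irreducible ?F")
proof
  assume irr: "irreducible ?F"
  define G :: "'a poly3" where
    "G = [: [: [:0, 0, c201:], [:0, c111:], [:c021:] :], [: [:0, c102:], [:c012:] :], [: [:c003:] :] :]"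
  have FG: "?F = [:0, 1:] * G"
    by (simp add: cubic_form_def G_def)
  have nu: "\<not> [:0, 1 :: 'a poly poly:] dvd 1"
    by (auto simp: is_unit_poly_iff)
  then have "G dvd 1"
    using irreducibleD[OF irr FG] by blast
  \<comment> \<open>A unit would have a unit z^0 coefficient, but this coefficient is a binary
    quadratic form, hence zero or nonconstant.\<close>
  then have "coeff G 0 dvd 1"
    by (auto simp: is_unit_poly_iff)
  then have "[: [:0, 0, c201:], [:0, c111:], [:c021:] :] dvd 1"
    by (simp add: G_def)
  then show False
    by (auto simp: is_unit_poly_iff split: if_splits)
qed

text \<open>The line x + j y = (p + j q) z contains (1 : j : 0) because 1 + j^2 = 0, and it visibly
  contains (p : q : 1).\<close>

lemma line_of_coeffs_isotropic:
  fixes l j p q :: "'a::field"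
  assumes "l \<noteq> 0" "j^2 = - 1"
  shows "line_of_coeffs l (l * j) (- l * (p + j * q)) = line_through (hpt p q 1) (hpt 1 j 0)"
proof -
  have jj: "j * (j * x) = - x" for x
    using assms(2) by (simp add: power2_eq_square flip: mult.assoc)
  have H: "hcoords (hpt p q 1) = {(k * p, k * q, k * 1) | k. k \<noteq> 0}"
    "hcoords (hpt 1 j 0) = {(k * 1, k * j, k * 0) | k. k \<noteq> 0}"
    by (rule hcoords_hpt; simp)+
  show ?thesis
  proof (intro set_eqI iffI)
    fix R assume "R \<in> line_of_coeffs l (l * j) (- l * (p + j * q))"
    then obtain x y z where R: "(x, y, z) \<in> hcoords R"
      and "l * x + l * j * y + - l * (p + j * q) * z = 0"
      unfolding line_of_coeffs_def by blast
    then have "l * (x + j * y - (p + j * q) * z) = 0" by (simp add: algebra_simps)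
    then have "x + j * y - (p + j * q) * z = 0" using assms(1) by simp
    then have x: "x = (p + j * q) * z - j * y" by (simp add: algebra_simps)
    \<comment> \<open>The third coordinate forces the weight z on (p, q, 1); the first then forces x
      - z p on (1, j, 0).\<close>
    have "y = z * q + (x - z * p) * j"
      unfolding x by (simp add: algebra_simps jj)
    then have "(z * p + (x - z * p) * 1, z * q + (x - z * p) * j, z * 1 + (x - z * p) * 0) \<in> hcoords R"
      using R by simp
    moreover have "(p, q, 1) \<in> hcoords (hpt p q 1)" "(1, j, 0) \<in> hcoords (hpt 1 j 0)"
      by (auto simp: hcoords_def)
    ultimately show "R \<in> line_through (hpt p q 1) (hpt 1 j 0)"
      unfolding line_through_def by blast
  next
    fix R assume "R \<in> line_through (hpt p q 1) (hpt 1 j 0)"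
    then obtain h k s t where
      "(s * (h * p) + t * k, s * (h * q) + t * (k * j), s * h) \<in> hcoords R" (is "?v \<in> _")
      unfolding line_through_def H by auto
    moreover have "l * fst ?v + l * j * fst (snd ?v) + - l * (p + j * q) * snd (snd ?v) = 0"
      by (simp add: algebra_simps jj)
    ultimately show "R \<in> line_of_coeffs l (l * j) (- l * (p + j * q))"
      unfolding line_of_coeffs_def by force
  qed
qed

text \<open>\<open>tangent_at\<close> ranges over all representatives (h, h j, 0). Rescaling by h
  multiplies the gradient of a cubic by h^2, which leaves the line unchanged. Keeping
  \<open>j\<close> abstract serves I and J alike.\<close>

lemma tangent_at_isotropic:
  fixes F :: "'a::field poly3"
  assumes j: "j^2 = - 1" and l: "l \<noteq> 0"
    and val: "\<And>h. eval3 F h (h * j) 0 = 0"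
    and grad: "\<And>h. eval3 (dx F) h (h * j) 0 = h^2 * l" "\<And>h. eval3 (dy F) h (h * j) 0 = h^2 * l * j"
      "\<And>h. eval3 (dz F) h (h * j) 0 = - (h^2 * l) * (p + j * q)"
  shows "tangent_at F (hpt 1 j 0) (line_through (hpt p q 1) (hpt 1 j 0))"
proof -
  have H: "hcoords (hpt 1 j 0) = {(h, h * j, 0) | h. h \<noteq> 0}"
    using hcoords_hpt[of 1 j 0] by simp
  have "line_of_coeffs (h^2 * l) (h^2 * l * j) (- (h^2 * l) * (p + j * q)) =
      line_through (hpt p q 1) (hpt 1 j 0)" if "h \<noteq> 0" for h
    using that l j by (intro line_of_coeffs_isotropic) auto
  moreover have "hpt 1 j 0 \<in> curve_points F"
    unfolding curve_points_def by (auto simp: H val)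
  ultimately show ?thesis
    unfolding tangent_at_def H using l by (auto simp only: grad) simp_all
qed

theorem theorem7p1:
  fixes F :: "real poly3" and A B C D P :: complex
  assumes "nondegenerate_cubic F"
    and "distinct [A, B, C, D]"
    and "is_isogonal_cubic F A B C D"
    and "is_spiral_center P A B C D"
  shows "tangent_at (complexify F) circ_I (line_through (embed_pt P) circ_I) \<and>
         tangent_at (complexify F) circ_J (line_through (embed_pt P) circ_J)"
proof -
  define w v where "w = (A + C) - (B + D)" and "v = A * C - B * D"
  obtain r u e f g where "r \<noteq> 0" and
    F: "F = cubic_form (r * Im w) (- r * Re w) (r * Im w) (- r * Re w)
       (r * (u - Im v)) (2 * r * Re v) (r * (u + Im v)) e f g"
    using isogonal_cubic_coeffs[OF assms(3)] unfolding w_def v_def by metis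
  have "w \<noteq> 0"
  proof
    assume "w = 0"
    then show False
      using assms(1) not_irreducible_cubic_form_at_infinity
      unfolding nondegenerate_cubic_def F by fastforce
  qed
  then have "(A - P) * (C - P) = (B - P) * (D - P)"
    using is_spiral_center_iff[OF assms(2)] assms(4) by (simp add: w_def)
  then have v: "v = P * w" by (simp add: v_def w_def algebra_simps)
  have "tangent_at (complexify F) (hpt 1 (\<sigma> * \<i>) 0)
      (line_through (hpt (of_real (Re P)) (of_real (Im P)) 1) (hpt 1 (\<sigma> * \<i>) 0))"
    if \<sigma>: "\<sigma> = 1 \<or> \<sigma> = - 1" for \<sigma>
  proof (rule tangent_at_isotropic)
    have ii: "\<i> * (\<i> * z) = - z" for z
      by (simp flip: mult.assoc)
    \<comment> \<open>The x-derivative at (1, \<sigma> i, 0). It equals -2 i r w for \<sigma> = 1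
      and 2 i r cnj w for \<sigma> = -1, so it is nonzero.\<close>
    let ?l = "2 * complex_of_real r * (Im w - \<sigma> * \<i> * Re w)"
    show "(\<sigma> * \<i>)^2 = - 1" using \<sigma> by (auto simp: power2_eq_square)
    show "?l \<noteq> 0"
      using \<sigma> \<open>r \<noteq> 0\<close> \<open>w \<noteq> 0\<close> by (auto simp: complex_eq_iff)
    fix h
    show "eval3 (complexify F) h (h * (\<sigma> * \<i>)) 0 = 0"
      using \<sigma> by (auto simp: F complexify_cubic_form eval3_cubic_form power2_eq_square
          power3_eq_cube algebra_simps ii)
    \<comment> \<open>In the z-derivative \<open>u\<close> cancels, as x^2 + y^2 = 0, leaving -2 r
      (Im v - \<sigma> i Re v) h^2. By v = P w, the bracket factors as (Im w - \<sigma> i Re w) (Re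
      P + \<sigma> i Im P).\<close>
    show "eval3 (dx (complexify F)) h (h * (\<sigma> * \<i>)) 0 = h^2 * ?l"
      "eval3 (dy (complexify F)) h (h * (\<sigma> * \<i>)) 0 = h^2 * ?l * (\<sigma> * \<i>)"
      "eval3 (dz (complexify F)) h (h * (\<sigma> * \<i>)) 0 =
        - (h^2 * ?l) * (of_real (Re P) + \<sigma> * \<i> * of_real (Im P))"
      using \<sigma> by (auto simp: F v complexify_cubic_form eval3_gradient_cubic_form power2_eq_square
          algebra_simps ii)
  qed
  from this[of 1] this[of "- 1"] show ?thesis
    by (simp add: circ_I_def circ_J_def embed_pt_def)
qed

end
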